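(* Let $a>0$, $b>0$. Then $(a,\,b,\,2a)\in\mathcal{P}_{1,2}$ if and only if $b>a+\frac12$. Moreover, in this case, for all $x>0$, $${}_1F_2\left(a\,;b,\,2a\,;-\tfrac{x^2}{4}\right)>\mathbb{J}_{b-1}^2\left(\frac{x}{2}\right).$$
   Context: For $a,b,c>0$, ${}_1F_2\left(a\,;b,c\,;-\frac{x^2}{4}\right)=\sum_{k=0}^\infty \frac{(a)_k}{k!\,(b)_k(c)_k}\left(-\frac{x^2}{4}\right)^k$, where $(\alpha)_k=\Gamma(\alpha+k)/\Gamma(\alpha)$. $\mathcal{P}_{1,2}$ denotes the set of all triples $(a,b,c)$ of positive reals such that this function is $>0$ for all $x>0$. For $\alpha>-1$, $\mathbb{J}_\alpha(x)={}_0F_1\left(\alpha+1\,;-\frac{x^2}{4}\right)=\Gamma(\alpha+1)(x/2)^{-\alpha}J_\alpha(x)$, with $J_\alpha$ the Bessel function of the first kind. *)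

theory Defs
  imports "HOL-Analysis.Analysis"
begin

definition hyp1F2 :: "real \<Rightarrow> real \<Rightarrow> real \<Rightarrow> real \<Rightarrow> real" where
  "hyp1F2 a b c x = (\<Sum>k. pochhammer a k / (fact k * pochhammer b k * pochhammer c k)
                          * (- (x^2) / 4) ^ k)"

text \<open>Normalized Bessel function: J_alpha(x) = 0F1(alpha+1; -x^2/4).\<close>
definition bessJ :: "real \<Rightarrow> real \<Rightarrow> real" where
  "bessJ \<alpha> x = (\<Sum>k. (- (x^2) / 4) ^ k / (fact k * pochhammer (\<alpha> + 1) k))"

definition P12 :: "(real \<times> real \<times> real) set" where
  "P12 = {(a, b, c). a > 0 \<and> b > 0 \<and> c > 0 \<and> (\<forall>x>0. hyp1F2 a b c x > 0)}"

end

theory Submission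
  imports Defs
begin

text \<open>Put \<open>\<nu> = b - 1\<close> and \<open>z = -x\<^sup>2/4\<close>. For \<open>b > a + 1/2\<close> Gasper's sums-of-squares method applies: one has
  \<open>\<^sub>1F\<^sub>2(a; b, 2a; z) = \<Sum>m. D\<^sub>m z\<^bsup>2m\<^esup> J\<^bsub>\<nu>+2m\<^esub>(x/2)\<^sup>2\<close> with normalized Bessel functions, \<open>D\<^sub>0 = 1\<close> and all
  \<open>D\<^sub>m > 0\<close>. Comparing coefficients, this is a terminating well-poised \<open>\<^sub>5F\<^sub>4\<close> summation, proved by
  telescoping; strictness holds because \<open>J\<^bsub>\<nu>+2m\<^esub>(x/2)\<close> tends to 1 as m grows.

  Conversely, Beta-averaging shows that positivity is inherited when b increases. So positivity
  for some \<open>b \<le> a + 1/2\<close> would give positivity for \<open>b = a + 1/2\<close>, where the function is the square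
  \<open>J\<^bsub>a-1/2\<^esub>(x/2)\<^sup>2\<close>. This has a zero: otherwise, averaging once more, some \<open>J\<^bsub>n-1/2\<^esub>\<close> would be positive,
  while Rolle's theorem carries the zeros of the cosine to all of these.\<close>

section \<open>Power series with a Pochhammer denominator, and averaging over its parameter\<close>

lemma pochhammer_ge_min:
  fixes b :: real
  assumes "b > 0"
  shows "min 1 b \<le> pochhammer b k"
proof (induction k)
  case (Suc k)
  show ?case
  proof (cases k)
    case (Suc j)
    have "pochhammer b k * 1 \<le> pochhammer b k * (b + real k)"
      using assms Suc by (intro mult_left_mono pochhammer_nonneg) auto
    then show ?thesis
      using Suc.IH by (simp add: pochhammer_Suc)
  qed simp
qed simp

text \<open>Comparison with the exponential series. The shape \<open>c k / pochhammer b k\<close>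
  isolates the denominator parameter that will be varied; it covers 0F1 with
  \<open>c k = 1 / fact k\<close> as well as 1F2, whose remaining factors go into
  \<open>c k\<close>.\<close>

lemma summable_pochhammer_series:
  fixes b z :: real and c :: "nat \<Rightarrow> real"
  assumes b: "b > 0" and c: "\<And>k. \<bar>c k\<bar> \<le> 1 / fact k"
  shows "summable (\<lambda>k. \<bar>c k / pochhammer b k * z ^ k\<bar>)"
proof (rule summable_comparison_test')
  show "summable (\<lambda>k. (1 / min 1 b) * (inverse (fact k) * \<bar>z\<bar> ^ k))"
    by (intro summable_mult summable_exp)
next
  fix k :: nat
  have "\<bar>c k / pochhammer b k * z ^ k\<bar> = \<bar>c k\<bar> / pochhammer b k * \<bar>z\<bar> ^ k"
    using b pochhammer_pos[of b k] by (simp add: abs_mult power_abs)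
  also have "\<dots> \<le> (1 / fact k) / min 1 b * \<bar>z\<bar> ^ k"
    using b c[of k] pochhammer_ge_min[OF b, of k]
    by (intro mult_right_mono frac_le) auto
  finally show "norm \<bar>c k / pochhammer b k * z ^ k\<bar> \<le> (1 / min 1 b) * (inverse (fact k) * \<bar>z\<bar> ^ k)"
    by (simp add: field_simps)
qed

text \<open>Up to the factor \<open>Beta b d\<close> these are the moments of the Beta(b, d)
  density: averaging \<open>t ^ k\<close> turns \<open>1 / pochhammer b k\<close> into
  \<open>1 / pochhammer (b + d) k\<close>.\<close>

lemma Beta_add_nat_left:
  fixes b d :: real
  assumes "b > 0" "d > 0"
  shows "Beta (b + real k) d = pochhammer b k / pochhammer (b + d) k * Beta b d"
proof (induction k)
  case (Suc k)
  have "(b + real k + d) * Beta (b + real k + 1) d = (b + real k) * Beta (b + real k) d"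
    using assms by (intro Beta_plus1_left) (auto elim!: nonpos_Ints_cases)
  then have "Beta (b + real (Suc k)) d = (b + real k) / (b + d + real k) * Beta (b + real k) d"
    using assms by (simp add: field_simps)
  then show ?case
    by (simp add: Suc.IH pochhammer_Suc mult_ac)
qed simp

text \<open>Raising the parameter from b to b + d is an average of the values at z t against the
  Beta(b, d) distribution in t. A uniform lower bound for the partial sums on the segment
  then survives the averaging, so no limit under the integral is needed.\<close>

lemma pochhammer_series_pos_raise:
  fixes b d z :: real and c :: "nat \<Rightarrow> real"
  assumes b: "b > 0" and d: "d > 0" and c: "\<And>k. \<bar>c k\<bar> \<le> 1 / fact k" and c0: "c 0 > 0"
    and pos: "\<And>z. z < 0 \<Longrightarrow> (\<Sum>k. c k / pochhammer b k * z ^ k) > 0" and z: "z < 0"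
  shows "(\<Sum>k. c k / pochhammer (b + d) k * z ^ k) > 0"
proof -
  define F where "F x = (\<Sum>k. c k / pochhammer b k * x ^ k)" for x
  define S where "S n x = (\<Sum>k<n. c k / pochhammer b k * x ^ k)" for n x
  note abs_summable = summable_pochhammer_series[OF b c]
  note summable = abs_summable[THEN summable_rabs_cancel]
  have "continuous_on {z..0} F"
    unfolding F_def
    by (intro continuous_at_imp_continuous_on ballI isCont_powser_converges_everywhere summable)
  then obtain w where w: "w \<in> {z..0}" "\<And>x. x \<in> {z..0} \<Longrightarrow> F w \<le> F x"
    using continuous_attains_inf[of "{z..0}" F] z by auto
  define \<delta> where "\<delta> = F w"
  \<comment> \<open>\<open>pos\<close> speaks only of negative arguments; a minimum attained at 0
    has the value \<open>c 0\<close>.\<close>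
  have "F 0 = c 0"
    unfolding F_def by (subst powser_zero) simp
  then have \<delta>: "\<delta> > 0"
    using pos[of w] w(1) c0 unfolding \<delta>_def F_def by (cases "w = 0") auto
  obtain N where "\<forall>n\<ge>N. norm (\<Sum>k. \<bar>c (k + n) / pochhammer b (k + n) * z ^ (k + n)\<bar>) < \<delta> / 2"
    using suminf_exist_split[OF half_gt_zero[OF \<delta>] abs_summable[of z]] by blast
  then have N: "(\<Sum>k. \<bar>c (k + n) / pochhammer b (k + n) * z ^ (k + n)\<bar>) < \<delta> / 2" if "n \<ge> N" for n
    using that by (auto dest!: spec[of _ n] simp del: abs_mult abs_divide)
  \<comment> \<open>On the whole segment the tail at x is dominated by the absolute tail at the
    endpoint z, so cutting the series costs less than \<open>\<delta> / 2\<close>.\<close>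
  have S_ge: "S n x \<ge> \<delta> / 2" if n: "n \<ge> N" and x: "x \<in> {z..0}" for n x
  proof -
    have sm: "summable (\<lambda>k. \<bar>c (k + n) / pochhammer b (k + n) * x ^ (k + n)\<bar>)" for x
      using abs_summable[of x] by (rule summable_ignore_initial_segment)
    have "F x - S n x = (\<Sum>k. c (k + n) / pochhammer b (k + n) * x ^ (k + n))"
      unfolding F_def S_def using suminf_split_initial_segment[OF summable[of x], of n] by simp
    also have "\<dots> \<le> (\<Sum>k. \<bar>c (k + n) / pochhammer b (k + n) * z ^ (k + n)\<bar>)"
    proof (rule suminf_le)
      fix k
      have "\<bar>x\<bar> ^ (k + n) \<le> \<bar>z\<bar> ^ (k + n)"
        using x by (intro power_mono) auto
      then have "\<bar>c (k + n) / pochhammer b (k + n) * x ^ (k + n)\<bar> \<le> \<bar>c (k + n) / pochhammer b (k + n) * z ^ (k + n)\<bar>"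
        by (simp only: abs_mult power_abs) (rule mult_left_mono, auto)
      then show "c (k + n) / pochhammer b (k + n) * x ^ (k + n) \<le> \<bar>c (k + n) / pochhammer b (k + n) * z ^ (k + n)\<bar>"
        by linarith
    qed (use sm[of z] sm[of x, THEN summable_rabs_cancel] in simp_all)
    finally show ?thesis
      using N[OF n] w(2)[OF x] unfolding \<delta>_def by linarith
  qed
  have B: "Beta b d > 0"
    using b d by (simp add: Beta_def)
  define T where "T n = (\<Sum>k<n. c k / pochhammer (b + d) k * z ^ k)" for n
  have T_ge: "T n \<ge> \<delta> / 2" if n: "n \<ge> N" for n
  proof -
    have *: "((\<lambda>t. t powr (b - 1) * (1 - t) powr (d - 1) * t ^ k) has_integral
            pochhammer b k / pochhammer (b + d) k * Beta b d) {0..1}" for k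
    proof (rule has_integral_eq)
      show "((\<lambda>t. t powr (b + real k - 1) * (1 - t) powr (d - 1)) has_integral
            pochhammer b k / pochhammer (b + d) k * Beta b d) {0..1}"
        using has_integral_Beta_real[of "b + real k" d] b d by (simp add: Beta_add_nat_left)
      \<comment> \<open>At \<open>t = 0\<close> both sides are 0, because
        \<open>0 powr y = 0\<close> for every y.\<close>
      show "t powr (b + real k - 1) * (1 - t) powr (d - 1) = t powr (b - 1) * (1 - t) powr (d - 1) * t ^ k"
        if "t \<in> {0..1}" for t
        using that b by (cases "t = 0") (auto simp: powr_add[symmetric] powr_realpow[symmetric] algebra_simps)
    qed
    have "((\<lambda>t. \<Sum>k<n. c k / pochhammer b k * z ^ k * (t powr (b - 1) * (1 - t) powr (d - 1) * t ^ k))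
            has_integral (\<Sum>k<n. c k / pochhammer b k * z ^ k * (pochhammer b k / pochhammer (b + d) k * Beta b d))) {0..1}"
      by (intro has_integral_sum has_integral_mult_right *) auto
    also have "(\<lambda>t. \<Sum>k<n. c k / pochhammer b k * z ^ k * (t powr (b - 1) * (1 - t) powr (d - 1) * t ^ k))
        = (\<lambda>t. t powr (b - 1) * (1 - t) powr (d - 1) * S n (z * t))"
      by (simp add: S_def sum_distrib_left power_mult_distrib mult_ac)
    also have "(\<Sum>k<n. c k / pochhammer b k * z ^ k * (pochhammer b k / pochhammer (b + d) k * Beta b d)) = T n * Beta b d"
      unfolding T_def sum_distrib_right
      by (intro sum.cong) (use pochhammer_pos[OF b] in \<open>simp_all add: less_imp_neq[symmetric]\<close>)
    finally have upper: "((\<lambda>t. t powr (b - 1) * (1 - t) powr (d - 1) * S n (z * t)) has_integral T n * Beta b d) {0..1}" .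
    have lower: "((\<lambda>t. t powr (b - 1) * (1 - t) powr (d - 1) * (\<delta> / 2)) has_integral Beta b d * (\<delta> / 2)) {0..1}"
      by (intro has_integral_mult_left has_integral_Beta_real b d)
    have "Beta b d * (\<delta> / 2) \<le> T n * Beta b d"
    proof (rule has_integral_le[OF lower upper])
      fix t :: real assume t: "t \<in> {0..1}"
      have "z * t \<in> {z..0}"
        using t z mult_left_le[of t "-z"] by (auto simp: mult_nonpos_nonneg)
      then show "t powr (b - 1) * (1 - t) powr (d - 1) * (\<delta> / 2)
          \<le> t powr (b - 1) * (1 - t) powr (d - 1) * S n (z * t)"
        by (intro mult_left_mono S_ge n) auto
    qed
    then show ?thesis
      using B by (simp add: mult.commute)
  qed
  have "summable (\<lambda>k. c k / pochhammer (b + d) k * z ^ k)"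
    using summable_pochhammer_series[of "b + d" c z, THEN summable_rabs_cancel] b d c by simp
  then have "T \<longlonglongrightarrow> (\<Sum>k. c k / pochhammer (b + d) k * z ^ k)"
    unfolding T_def by (rule summable_LIMSEQ)
  then have "\<delta> / 2 \<le> (\<Sum>k. c k / pochhammer (b + d) k * z ^ k)"
    by (rule LIMSEQ_le_const) (use T_ge in blast)
  then show ?thesis
    using \<delta> by linarith
qed

section \<open>Zeros and nonvanishing of 0F1\<close>

definition hyp0F1 :: "real \<Rightarrow> real \<Rightarrow> real" where
  "hyp0F1 b z = (\<Sum>k. (1 / fact k) / pochhammer b k * z ^ k)"

lemma bessJ_eq_hyp0F1: "bessJ \<alpha> x = hyp0F1 (\<alpha> + 1) (- (x\<^sup>2) / 4)"
  by (simp add: bessJ_def hyp0F1_def)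

lemma summable_hyp0F1:
  "b > 0 \<Longrightarrow> summable (\<lambda>k. \<bar>(1 / fact k) / pochhammer b k * z ^ k\<bar>)" for b z :: real
  by (rule summable_pochhammer_series) auto

text \<open>Differentiation raises the parameter by one because
  \<open>pochhammer b (Suc k) = b * pochhammer (b + 1) k\<close>; this lets Rolle's theorem pass
  zeros from b to b + 1.\<close>

lemma has_field_derivative_hyp0F1:
  assumes "b > 0"
  shows "(hyp0F1 b has_field_derivative hyp0F1 (b + 1) z / b) (at z)"
proof -
  have "((\<lambda>z. \<Sum>k. (1 / fact k) / pochhammer b k * z ^ k) has_field_derivative
      (\<Sum>k. diffs (\<lambda>k. (1 / fact k) / pochhammer b k) k * z ^ k)) (at z)"
    by (intro termdiffs_strong_converges_everywhere summable_hyp0F1[THEN summable_rabs_cancel] assms)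
  also have "(\<Sum>k. diffs (\<lambda>k. (1 / fact k) / pochhammer b k) k * z ^ k)
      = (\<Sum>k. ((1 / fact k) / pochhammer (b + 1) k * z ^ k) / b)"
    by (simp add: diffs_def pochhammer_rec field_simps del: of_nat_Suc)
  also have "\<dots> = hyp0F1 (b + 1) z / b"
    unfolding hyp0F1_def using assms
    by (intro suminf_divide summable_hyp0F1[THEN summable_rabs_cancel]) simp
  finally show ?thesis
    by (simp add: hyp0F1_def[abs_def])
qed

text \<open>The duplication formula gives
  \<open>fact (2 * n) = 4 ^ n * pochhammer (1/2) n * fact n\<close>, which matches the cosine
  series.\<close>

lemma hyp0F1_half: "hyp0F1 (1/2) (- (x\<^sup>2) / 4) = cos x"
proof -
  have "(\<lambda>n. (-1) ^ n * x ^ (2 * n) / fact (2 * n)) sums cos x"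
    using cos_paired[of x] by (simp add: field_simps)
  moreover have "(-1) ^ n * x ^ (2 * n) / fact (2 * n)
      = (1 / fact n) / pochhammer (1/2) n * (- (x\<^sup>2) / 4) ^ n" for n
  proof -
    have "fact (2 * n) = 4 ^ n * pochhammer (1/2::real) n * fact n"
      using pochhammer_double[of "1/2::real" n] by (simp add: pochhammer_fact power_mult)
    moreover have "(- (x\<^sup>2) / 4) ^ n = (-1) ^ n * x ^ (2 * n) / 4 ^ n"
      by (simp add: power_divide power_mult power_minus[of "x\<^sup>2 / 4"])
    ultimately show ?thesis
      by simp
  qed
  ultimately show ?thesis
    unfolding hyp0F1_def by (simp add: sums_iff)
qed

text \<open>Zeros are sought below every bound Z so that the induction hypothesis always supplies
  two of them, u < v < Z, with a zero for the next parameter in between.\<close>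

lemma hyp0F1_half_nat_zero: "\<exists>z<Z. hyp0F1 (1/2 + real n) z = 0"
proof (induction n arbitrary: Z)
  case 0
  obtain k :: nat where k: "real k > \<bar>Z\<bar>"
    using reals_Archimedean2 by blast
  \<comment> \<open>An odd multiple of \<open>pi / 2\<close>, hence a zero of the cosine, with
    \<open>x \<ge> 2 * k + 1\<close> and so \<open>x^2 / 4 \<ge> k > \<bar>Z\<bar>\<close>.\<close>
  define x where "x = (2 * real k + 1) * (pi / 2)"
  have "hyp0F1 (1/2) (- (x\<^sup>2) / 4) = 0"
    unfolding hyp0F1_half x_def cos_zero_iff by (intro disjI1 exI[of _ "2 * k + 1"]) simp
  moreover have "- (x\<^sup>2) / 4 < Z"
  proof -
    have "(2 * real k + 1) * 1 \<le> x"
      unfolding x_def using pi_gt3 by (intro mult_left_mono) auto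
    then have "(2 * real k + 1)\<^sup>2 \<le> x\<^sup>2"
      by (intro power_mono) auto
    then have "real k \<le> x\<^sup>2 / 4"
      by (simp add: power2_eq_square algebra_simps) (smt (verit) mult_nonneg_nonneg of_nat_0_le_iff)
    then show ?thesis
      using k by linarith
  qed
  ultimately show ?case
    by auto
next
  case (Suc n)
  define b where "b = 1/2 + real n"
  have b: "b > 0"
    by (simp add: b_def)
  obtain v where v: "v < Z" "hyp0F1 b v = 0"
    using Suc unfolding b_def by blast
  obtain u where u: "u < v" "hyp0F1 b u = 0"
    using Suc unfolding b_def by blast
  have "\<exists>w>u. w < v \<and> (\<lambda>h. h * (hyp0F1 (b + 1) w / b)) = (\<lambda>h. 0)"
  proof (rule Rolle_deriv[OF u(1)])
    show "continuous_on {u..v} (hyp0F1 b)"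
      using has_field_derivative_hyp0F1[OF b] DERIV_isCont
      by (intro continuous_at_imp_continuous_on) blast
    show "(hyp0F1 b has_derivative (\<lambda>h. h * (hyp0F1 (b + 1) x / b))) (at x)" for x
      using has_field_derivative_hyp0F1[OF b, of x]
      unfolding has_field_derivative_def by (rule has_derivative_eq_rhs) (simp add: fun_eq_iff)
  qed (use u v in simp)
  \<comment> \<open>Rolle's theorem gave the vanishing derivative as an equality of linear maps;
    evaluation at \<open>h = 1\<close> extracts its value.\<close>
  then obtain w where "u < w" "w < v" "1 * (hyp0F1 (b + 1) w / b) = 0"
    by metis
  then show ?case
    using v(1) b by (intro exI[of _ w]) (auto simp: b_def add_ac)
qed

lemma bessJ_zero:
  assumes "\<alpha> > -1"
  shows "\<exists>x>0. bessJ \<alpha> x = 0"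
proof (rule ccontr)
  assume no_zero: "\<not> ?thesis"
  have nz: "hyp0F1 (\<alpha> + 1) z \<noteq> 0" if "z < 0" for z
  proof -
    have "z = - ((2 * sqrt (- z))\<^sup>2) / 4"
      using that by (simp add: power_mult_distrib)
    then have "hyp0F1 (\<alpha> + 1) z = bessJ \<alpha> (2 * sqrt (- z))"
      unfolding bessJ_eq_hyp0F1 by metis
    then show ?thesis
      using no_zero that by auto
  qed
  have one: "hyp0F1 (\<alpha> + 1) 0 = 1"
    unfolding hyp0F1_def by (subst powser_zero) simp
  \<comment> \<open>The value at 0 is 1, so by continuity a nonpositive value would force a zero on
    the negative axis.\<close>
  have pos: "hyp0F1 (\<alpha> + 1) z > 0" if z: "z < 0" for z
  proof (rule ccontr)
    assume "\<not> ?thesis"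
    moreover have "isCont (hyp0F1 (\<alpha> + 1)) x" for x
      using has_field_derivative_hyp0F1[of "\<alpha> + 1" x] DERIV_isCont assms by auto
    ultimately obtain y where "z \<le> y" "y \<le> 0" "hyp0F1 (\<alpha> + 1) y = 0"
      using IVT[of "hyp0F1 (\<alpha> + 1)" z 0 0] z one by auto
    then show False
      using nz[of y] one by (cases "y = 0") auto
  qed
  \<comment> \<open>This n makes the increment from \<open>\<alpha> + 1\<close> to
    \<open>1/2 + real n\<close> positive, as the averaging requires.\<close>
  obtain n :: nat where n: "real n > \<alpha> + 1"
    using reals_Archimedean2 by blast
  obtain z where z: "z < 0" "hyp0F1 (1/2 + real n) z = 0"
    using hyp0F1_half_nat_zero by blast
  have "hyp0F1 (\<alpha> + 1 + (1/2 + real n - (\<alpha> + 1))) z > 0"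
    unfolding hyp0F1_def
    by (rule pochhammer_series_pos_raise) (use assms n z pos in \<open>auto simp: hyp0F1_def\<close>)
  then show False
    using z by simp
qed

text \<open>For k > 0 one has \<open>pochhammer b k \<ge> b\<close>, so the distance of the value
  from 1 is at most \<open>(exp \<bar>z\<bar> - 1) / b < 1\<close>. This later guarantees a nonzero
  square with positive index in the expansion.\<close>

lemma hyp0F1_nonzero:
  assumes "b \<ge> exp \<bar>z\<bar>"
  shows "hyp0F1 b z \<noteq> 0"
proof -
  have b: "b \<ge> 1"
    using assms one_le_exp_iff[of "\<bar>z\<bar>"] by linarith
  define u where "u k = (1 / fact k) / pochhammer b k * z ^ k" for k
  have abs_summable: "summable (\<lambda>k. \<bar>u k\<bar>)"
    unfolding u_def using b by (intro summable_hyp0F1) auto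
  then have abs_summable1: "summable (\<lambda>k. \<bar>u (Suc k)\<bar>)"
    by (subst summable_Suc_iff)
  have "(\<lambda>k. inverse (fact k) * \<bar>z\<bar> ^ k) sums exp \<bar>z\<bar>"
    using exp_converges[of "\<bar>z\<bar>"] by simp
  then have exp_sums: "(\<lambda>k. inverse (fact (Suc k)) * \<bar>z\<bar> ^ Suc k / b) sums ((exp \<bar>z\<bar> - 1) / b)"
    by (intro sums_divide) (subst sums_Suc_iff, simp)
  have "hyp0F1 b z - 1 = (\<Sum>k. u (Suc k))"
    using suminf_split_head[OF abs_summable[THEN summable_rabs_cancel]]
    unfolding hyp0F1_def u_def by simp
  then have "\<bar>hyp0F1 b z - 1\<bar> \<le> (\<Sum>k. \<bar>u (Suc k)\<bar>)"
    using summable_rabs[OF abs_summable1] by simp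
  also have "\<dots> \<le> (\<Sum>k. inverse (fact (Suc k)) * \<bar>z\<bar> ^ Suc k / b)"
  proof (intro suminf_le abs_summable1 sums_summable[OF exp_sums])
    fix k
    have "b * 1 \<le> b * pochhammer (b + 1) k"
      using pochhammer_ge_min[of "b + 1" k] b by (intro mult_left_mono) auto
    then have "b \<le> pochhammer b (Suc k)"
      by (simp add: pochhammer_rec)
    then have "inverse (fact (Suc k)) * \<bar>z\<bar> ^ Suc k / pochhammer b (Suc k)
        \<le> inverse (fact (Suc k)) * \<bar>z\<bar> ^ Suc k / b"
      using b by (intro divide_left_mono) auto
    moreover have "\<bar>u (Suc k)\<bar> = inverse (fact (Suc k)) * \<bar>z\<bar> ^ Suc k / pochhammer b (Suc k)"
      unfolding u_def using pochhammer_pos[of b "Suc k"] b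
      by (simp add: abs_mult power_abs field_simps del: power_Suc fact_Suc)
    ultimately show "\<bar>u (Suc k)\<bar> \<le> inverse (fact (Suc k)) * \<bar>z\<bar> ^ Suc k / b"
      by simp
  qed
  also have "\<dots> = (exp \<bar>z\<bar> - 1) / b"
    using exp_sums by (simp add: sums_iff)
  also have "\<dots> < 1"
    using assms b by (simp add: field_simps)
  finally show ?thesis
    by auto
qed

section \<open>The square of 0F1 as a 1F2\<close>

text \<open>Multiplied by \<open>(pochhammer b k)^2\<close>, the summands become products of
  generalized binomials with upper entry b + k - 1. Vandermonde's convolution sums them, and the
  duplication formula splits \<open>pochhammer (2 * b - 1) (2 * k)\<close>.\<close>

lemma hyp0F1_square_coeff:
  fixes b :: real
  assumes b: "b > 1/2"
  shows "(\<Sum>j\<le>k. (1 / fact j) / pochhammer b j * ((1 / fact (k - j)) / pochhammer b (k - j)))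
     = 4 ^ k * pochhammer (b - 1/2) k / (fact k * pochhammer b k * pochhammer (2 * b - 1) k)"
proof -
  have pos: "pochhammer b j > 0" "pochhammer (2 * b - 1) j > 0" for j
    using b by (auto intro!: pochhammer_pos)
  have choose: "(b + real k - 1) gchoose j = pochhammer b k / (pochhammer b (k - j) * fact j)" if "j \<le> k" for j
  proof -
    have "pochhammer b k = pochhammer b (k - j) * pochhammer (b + real k - real j) j"
      using pochhammer_product'[of b "k - j" j] that by (simp add: of_nat_diff algebra_simps)
    then show ?thesis
      using pos[of "k - j"] unfolding gbinomial_pochhammer' by (simp add: algebra_simps)
  qed
  have "(pochhammer b k)\<^sup>2 * (\<Sum>j\<le>k. (1 / fact j) / pochhammer b j * ((1 / fact (k - j)) / pochhammer b (k - j)))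
      = (\<Sum>j\<le>k. ((b + real k - 1) gchoose j) * ((b + real k - 1) gchoose (k - j)))"
    unfolding sum_distrib_left
    by (intro sum.cong) (simp_all add: choose power2_eq_square)
  also have "\<dots> = (2 * b + 2 * real k - 2) gchoose k"
    using gbinomial_Vandermonde[of "b + real k - 1" "b + real k - 1" k]
    by (simp add: atLeast0AtMost algebra_simps)
  also have "\<dots> = pochhammer (2 * b - 1 + real k) k / fact k"
    unfolding gbinomial_pochhammer' by (simp add: algebra_simps)
  also have "\<dots> = pochhammer (2 * b - 1) (2 * k) / (fact k * pochhammer (2 * b - 1) k)"
    using pos(2)[of k] pochhammer_product'[of "2 * b - 1" k k, folded mult_2] by simp
  also have "pochhammer (2 * b - 1) (2 * k) = 4 ^ k * pochhammer (b - 1/2) k * pochhammer b k"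
    using pochhammer_double[of "b - 1/2" k] by (simp add: right_diff_distrib power_mult)
  finally show ?thesis
    using pos[of k] by (simp add: field_simps power2_eq_square)
qed

text \<open>Cauchy product; evaluating at \<open>z / 4\<close> absorbs the factor
  \<open>4 ^ k\<close> of the coefficients.\<close>

lemma hyp0F1_square_sums:
  assumes b: "b > 1/2"
  shows "(\<lambda>k. pochhammer (b - 1/2) k / (fact k * pochhammer b k * pochhammer (2 * b - 1) k) * z ^ k)
           sums (hyp0F1 b (z / 4))\<^sup>2"
proof -
  have summable: "summable (\<lambda>k. norm ((1 / fact k) / pochhammer b k * (z / 4) ^ k))"
    using summable_hyp0F1[of b "z / 4"] b by simp
  have "(\<lambda>k. \<Sum>j\<le>k. ((1 / fact j) / pochhammer b j * (z / 4) ^ j)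
      * ((1 / fact (k - j)) / pochhammer b (k - j) * (z / 4) ^ (k - j))) sums (hyp0F1 b (z / 4))\<^sup>2"
    unfolding hyp0F1_def power2_eq_square by (rule Cauchy_product_sums[OF summable summable])
  also have "(\<lambda>k. \<Sum>j\<le>k. ((1 / fact j) / pochhammer b j * (z / 4) ^ j)
      * ((1 / fact (k - j)) / pochhammer b (k - j) * (z / 4) ^ (k - j)))
    = (\<lambda>k. pochhammer (b - 1/2) k / (fact k * pochhammer b k * pochhammer (2 * b - 1) k) * z ^ k)"
  proof
    fix k
    have "(\<Sum>j\<le>k. ((1 / fact j) / pochhammer b j * (z / 4) ^ j)
        * ((1 / fact (k - j)) / pochhammer b (k - j) * (z / 4) ^ (k - j)))
      = (\<Sum>j\<le>k. (1 / fact j) / pochhammer b j * ((1 / fact (k - j)) / pochhammer b (k - j))) * (z / 4) ^ k"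
      unfolding sum_distrib_right
    proof (intro sum.cong refl)
      fix j assume "j \<in> {..k}"
      then have "(z / 4) ^ k = (z / 4) ^ j * (z / 4) ^ (k - j)"
        by (simp add: power_add[symmetric])
      then show "((1 / fact j) / pochhammer b j * (z / 4) ^ j)
          * ((1 / fact (k - j)) / pochhammer b (k - j) * (z / 4) ^ (k - j))
        = (1 / fact j) / pochhammer b j * ((1 / fact (k - j)) / pochhammer b (k - j)) * (z / 4) ^ k"
        by (simp only: mult_ac)
    qed
    then show "(\<Sum>j\<le>k. ((1 / fact j) / pochhammer b j * (z / 4) ^ j)
        * ((1 / fact (k - j)) / pochhammer b (k - j) * (z / 4) ^ (k - j)))
      = pochhammer (b - 1/2) k / (fact k * pochhammer b k * pochhammer (2 * b - 1) k) * z ^ k"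
      unfolding hyp0F1_square_coeff[OF b] by (simp add: power_divide)
  qed
  finally show ?thesis .
qed

section \<open>Gasper's weights and the terminating summation\<close>

text \<open>This is (-1)^j (-k)_j. Subtraction takes place in the reals, and the zero factor at i =
  k makes the sums over m terminate.\<close>

definition falling :: "nat \<Rightarrow> nat \<Rightarrow> real" where
  "falling k j = (\<Prod>i<j. real k - real i)"

lemma falling_Suc: "falling k (Suc j) = falling k j * (real k - real j)"
  by (simp add: falling_def)

lemma falling_Suc_Suc: "falling (Suc k) (Suc j) = (real k + 1) * falling k j"
  unfolding falling_def prod.lessThan_Suc_shift by simp

lemma falling_eq_0: "k < j \<Longrightarrow> falling k j = 0"
  by (auto simp: falling_def)

lemma falling_add_nat: "falling (j + n) n = fact (j + n) / fact j"
proof (induction n)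
  case (Suc n)
  then show ?case
    using falling_Suc_Suc[of "j + n" n] by (simp add: algebra_simps)
qed (simp add: falling_def)

lemma falling_nonneg: "falling k j \<ge> 0"
proof (cases "k < j")
  case False
  then show ?thesis
    unfolding falling_def by (intro prod_nonneg) auto
qed (simp add: falling_eq_0)

text \<open>For \<open>m > 0\<close> the weight is \<open>(\<nu> + 2 m) / \<nu> (\<nu>)\<^sub>m (\<nu> + 1/2 - a)\<^sub>m / (m! (a + 1/2)\<^sub>m)\<close> with \<open>\<nu> = b - 1\<close>.
  The factor \<open>(\<nu>)\<^sub>m / \<nu>\<close> is cancelled because \<open>\<nu> = 0\<close> is allowed.\<close>

definition gasper_weight :: "real \<Rightarrow> real \<Rightarrow> nat \<Rightarrow> real" where
  "gasper_weight a b m = (case m of 0 \<Rightarrow> 1 | Suc j \<Rightarrow>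
     (b + 2 * real j + 1) * pochhammer b j * pochhammer (b - 1/2 - a) (Suc j)
       / (fact (Suc j) * pochhammer (a + 1/2) (Suc j)))"

text \<open>Only the factor \<open>pochhammer (b - 1/2 - a) (Suc j)\<close> has a sign that depends
  on \<open>b > a + 1/2\<close>; the others are positive for positive a and b.\<close>

lemma gasper_weight_pos:
  assumes "a > 0" "b > a + 1/2"
  shows "gasper_weight a b m > 0"
proof (cases m)
  case (Suc j)
  show ?thesis
    unfolding gasper_weight_def Suc using assms
    by (auto intro!: divide_pos_pos mult_pos_pos pochhammer_pos simp del: fact_Suc)
qed (simp add: gasper_weight_def)

text \<open>Contribution of the m-th square to the coefficient of \<open>z ^ k\<close>, with the
  m-independent factor \<open>pochhammer (b - 1/2) k / (fact k * pochhammer b k)\<close>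
  removed.\<close>

definition gasper_term :: "real \<Rightarrow> real \<Rightarrow> nat \<Rightarrow> nat \<Rightarrow> real" where
  "gasper_term a b k m = gasper_weight a b m * falling k (2 * m) / pochhammer (2 * b - 1) (k + 2 * m)"

text \<open>A WZ-style certificate: the closed form of the partial sum on the right-hand side vanishes
  once \<open>k \<le> 2 M\<close>, which leaves a first-order recurrence in k for the full sum.\<close>

lemma gasper_term_telescope:
  assumes a: "a > 0" and b: "b > 1/2"
  shows "(\<Sum>m\<le>M. (b - 1/2 + real k) * (2 * a + real k) * gasper_term a b (Suc k) m
              - (a + real k) * gasper_term a b k m)
    = - (pochhammer b M * pochhammer (b - 1/2 - a) (Suc M) / (fact M * pochhammer (a + 1/2) M)
        * falling k (2 * M + 1) / pochhammer (2 * b - 1) (k + 2 * M + 1))"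
proof (induction M)
  case 0
  have "pochhammer (2 * b - 1) k > 0" "2 * b - 1 + real k > 0"
    using b by (auto intro!: pochhammer_pos)
  then show ?case
    by (simp add: gasper_term_def gasper_weight_def falling_def pochhammer_Suc divide_simps)
       (simp add: algebra_simps)
next
  case (Suc M)
  \<comment> \<open>\<open>U\<close>, \<open>q\<close> and \<open>P\<close> build the closed form at
    M; \<open>X\<close> and \<open>V\<close> collect new denominator factors that appear at M +
    1.\<close>
  define U where "U = pochhammer b M * pochhammer (b - 1/2 - a) (Suc M) / (fact M * pochhammer (a + 1/2) M)"
  define q where "q = falling k (2 * M + 1)"
  define P where "P = pochhammer (2 * b - 1) (k + 2 * M + 1)"
  define X where "X = 2 * b + real k + 2 * real M"
  define V where "V = (1 + real M) * (a + 1/2 + real M)"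
  have P: "P > 0" and X: "X > 0" and V: "V > 0"
    unfolding P_def X_def V_def using a b by (auto intro!: pochhammer_pos mult_pos_pos)
  have P2: "pochhammer (2 * b - 1) (k + 2 * Suc M) = P * X"
    unfolding P_def X_def by (simp add: pochhammer_Suc algebra_simps)
  have P3: "pochhammer (2 * b - 1) (Suc k + 2 * Suc M) = P * X * (X + 1)"
    unfolding P_def X_def by (simp add: pochhammer_Suc algebra_simps)
  have q2: "falling k (2 * Suc M) = q * (real k - 2 * real M - 1)"
    unfolding q_def by (simp add: falling_Suc)
  have q3: "falling (Suc k) (2 * Suc M) = (real k + 1) * q"
    unfolding q_def by (simp add: falling_Suc_Suc)
  have q4: "falling k (2 * Suc M + 1) = q * (real k - 2 * real M - 1) * (real k - 2 * real M - 2)"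
    unfolding q_def by (simp add: falling_Suc diff_diff_eq add.commute)
  have E: "gasper_weight a b (Suc M) = (b + 2 * real M + 1) * U / V"
    unfolding gasper_weight_def U_def V_def 
    by (simp add: pochhammer_Suc[of "a + 1/2"] mult_ac add_ac)
  have H: "pochhammer b (Suc M) * pochhammer (b - 1/2 - a) (Suc (Suc M)) / (fact (Suc M) * pochhammer (a + 1/2) (Suc M))
      = U * (b + real M) * (b + 1/2 - a + real M) / V"
  proof -
    have "b - 1/2 - a + real (Suc M) = b + 1/2 - a + real M"
      by simp
    then show ?thesis
      unfolding U_def V_def pochhammer_Suc[of _ "Suc M"] pochhammer_Suc[of b] pochhammer_Suc[of "a + 1/2"]
      by (simp add: mult_ac)
  qed
  \<comment> \<open>With common factors cleared, the induction step is this polynomial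
    identity.\<close>
  have key: "(b + 2 * real M + 1) * ((b - 1/2 + real k) * (2 * a + real k) * (real k + 1)
        - (a + real k) * (real k - 2 * real M - 1) * (X + 1)) - V * X * (X + 1)
      = - ((b + real M) * (b + 1/2 - a + real M) * (real k - 2 * real M - 1) * (real k - 2 * real M - 2))"
    unfolding X_def V_def by algebra
  have "(b - 1/2 + real k) * (2 * a + real k) * gasper_term a b (Suc k) (Suc M)
        - (a + real k) * gasper_term a b k (Suc M) - U * q / P
    = U * q / (V * P * X * (X + 1)) * ((b + 2 * real M + 1) * ((b - 1/2 + real k) * (2 * a + real k) * (real k + 1)
        - (a + real k) * (real k - 2 * real M - 1) * (X + 1)) - V * X * (X + 1))"
    unfolding gasper_term_def P2 P3 q2 q3 E using P X V
    by (simp add: divide_simps) (simp add: algebra_simps)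
  also have "\<dots> = - (U * (b + real M) * (b + 1/2 - a + real M) / V
        * (q * (real k - 2 * real M - 1) * (real k - 2 * real M - 2)) / (P * X * (X + 1)))"
    unfolding key by (simp add: mult_ac)
  finally show ?case
    unfolding sum.atMost_Suc Suc.IH H q4 U_def[symmetric] q_def[symmetric] P_def[symmetric]
    using P3 by simp
qed

text \<open>For \<open>k < 2 * M + 1\<close> the certificate is 0, so both sides satisfy the same
  first-order recurrence in k; at k = 0 only m = 0 contributes, with value 1.\<close>

lemma sum_gasper_term:
  assumes a: "a > 0" and b: "b > 1/2"
  shows "k \<le> 2 * M \<Longrightarrow> (\<Sum>m\<le>M. gasper_term a b k m)
           = pochhammer a k / (pochhammer (b - 1/2) k * pochhammer (2 * a) k)"
proof (induction k)
  case 0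
  have "gasper_term a b 0 m = (if m = 0 then 1 else 0)" for m
    by (auto simp: gasper_term_def gasper_weight_def falling_eq_0 falling_def)
  then show ?case
    by simp
next
  case (Suc k)
  let ?c = "(b - 1/2 + real k) * (2 * a + real k)"
  have "?c > 0"
    using a b by (auto intro!: mult_pos_pos)
  moreover have "?c * (\<Sum>m\<le>M. gasper_term a b (Suc k) m) - (a + real k) * (\<Sum>m\<le>M. gasper_term a b k m) = 0"
    using gasper_term_telescope[OF a b, of k M] Suc.prems
    by (simp add: falling_eq_0 sum_subtractf sum_distrib_left)
  ultimately have "(\<Sum>m\<le>M. gasper_term a b (Suc k) m) = (a + real k) * (\<Sum>m\<le>M. gasper_term a b k m) / ?c"
    by (simp add: nonzero_eq_divide_eq[OF less_imp_neq[symmetric]] mult.commute)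
  then show ?case
    using Suc by (simp add: pochhammer_Suc mult_ac)
qed

lemma gasper_term_nonneg:
  assumes "a > 0" "b > a + 1/2"
  shows "gasper_term a b k m \<ge> 0"
  unfolding gasper_term_def using gasper_weight_pos[OF assms, of m] assms
  by (intro divide_nonneg_nonneg mult_nonneg_nonneg falling_nonneg pochhammer_nonneg) auto

text \<open>The D_m of the expansion: the k-independent part of the Pochhammer symbols after
  shifting k by 2 m.\<close>

definition gasper_coeff :: "real \<Rightarrow> real \<Rightarrow> nat \<Rightarrow> real" where
  "gasper_coeff a b m = gasper_weight a b m * pochhammer (b - 1/2) (2 * m)
     / (pochhammer (2 * b - 1) (4 * m) * pochhammer b (2 * m))"

lemma gasper_coeff_pos:
  assumes "a > 0" "b > a + 1/2"
  shows "gasper_coeff a b m > 0"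
  unfolding gasper_coeff_def using gasper_weight_pos[OF assms] assms
  by (intro divide_pos_pos mult_pos_pos pochhammer_pos) auto

text \<open>The falling factorial kills the first 2 m terms. After the shift it turns
  \<open>fact (k + 2 * m)\<close> into \<open>fact k\<close>, leaving the series of the squared 0F1
  with parameter b + 2 m.\<close>

lemma gasper_term_sums:
  assumes b: "b > 1/2"
  shows "(\<lambda>k. gasper_term a b k m * pochhammer (b - 1/2) k / (fact k * pochhammer b k) * z ^ k)
           sums (gasper_coeff a b m * z ^ (2 * m) * (hyp0F1 (b + 2 * real m) (z / 4))\<^sup>2)"
    (is "?f sums _")
proof -
  define c where "c = b + 2 * real m"
  have c: "c > 1/2"
    using b by (simp add: c_def)
  have "?f (k + 2 * m) = gasper_coeff a b m * z ^ (2 * m)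
      * (pochhammer (c - 1/2) k / (fact k * pochhammer c k * pochhammer (2 * c - 1) k) * z ^ k)" for k
  proof -
    have shift: "pochhammer x (k + n) = pochhammer x n * pochhammer (x + real n) k" for x n
      using pochhammer_product'[of x n k] by (simp add: add.commute)
    have 1: "pochhammer b (k + 2 * m) = pochhammer b (2 * m) * pochhammer c k"
      "pochhammer (b - 1/2) (k + 2 * m) = pochhammer (b - 1/2) (2 * m) * pochhammer (c - 1/2) k"
      "pochhammer (2 * b - 1) (k + 2 * m + 2 * m) = pochhammer (2 * b - 1) (4 * m) * pochhammer (2 * c - 1) k"
      using shift[of b "2 * m"] shift[of "b - 1/2" "2 * m"] shift[of "2 * b - 1" "4 * m"]
      by (simp_all add: c_def algebra_simps)
    show ?thesis
      unfolding gasper_term_def gasper_coeff_def 1 falling_add_nat power_add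
      by (simp add: mult_ac)
  qed
  then have "(\<lambda>k. ?f (k + 2 * m)) sums (gasper_coeff a b m * z ^ (2 * m) * (hyp0F1 c (z / 4))\<^sup>2)"
    using sums_mult[OF hyp0F1_square_sums[OF c, of z], of "gasper_coeff a b m * z ^ (2 * m)"] by simp
  moreover have "(\<Sum>k<2 * m. ?f k) = 0"
    by (intro sum.neutral) (simp add: gasper_term_def falling_eq_0)
  ultimately show ?thesis
    unfolding c_def using sums_iff_shift[of ?f "2 * m"] by simp
qed

section \<open>The expansion of 1F2 in squares and the strict inequality\<close>

definition hyp1F2z :: "real \<Rightarrow> real \<Rightarrow> real \<Rightarrow> real \<Rightarrow> real" where
  "hyp1F2z a b c z = (\<Sum>k. (pochhammer a k / (fact k * pochhammer c k)) / pochhammer b k * z ^ k)"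

lemma hyp1F2_eq_hyp1F2z: "hyp1F2 a b c x = hyp1F2z a b c (- (x\<^sup>2) / 4)"
  by (simp add: hyp1F2_def hyp1F2z_def mult_ac)

lemma pochhammer_mono:
  fixes a c :: real
  assumes "0 < a" "a \<le> c"
  shows "pochhammer a k \<le> pochhammer c k"
  unfolding pochhammer_prod using assms by (intro prod_mono) auto

lemma hyp1F2z_coeff_bound:
  fixes a c :: real
  assumes "0 < a" "a \<le> c"
  shows "\<bar>pochhammer a k / (fact k * pochhammer c k)\<bar> \<le> 1 / fact k"
  using pochhammer_mono[OF assms, of k] pochhammer_pos[OF assms(1), of k] by (simp add: field_simps)

text \<open>The order of summation is exchanged by domination. The coefficients \<open>p M k\<close>
  of the M-th partial sum lie between 0 and \<open>T k\<close> and equal \<open>T k\<close> for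
  \<open>k \<le> 2 * M\<close>, so the error is at most a tail of the absolutely convergent series
  of T.\<close>

lemma hyp1F2z_gasper_sums:
  assumes a: "a > 0" and b: "b > a + 1/2"
  shows "(\<lambda>m. gasper_coeff a b m * z ^ (2 * m) * (hyp0F1 (b + 2 * real m) (z / 4))\<^sup>2)
           sums hyp1F2z a b (2 * a) z"
proof -
  define r where "r k = pochhammer (b - 1/2) k / (fact k * pochhammer b k)" for k
  define T where "T k = (pochhammer a k / (fact k * pochhammer (2 * a) k)) / pochhammer b k" for k
  define p where "p M k = (\<Sum>m\<le>M. gasper_term a b k m) * r k" for M k
  have b': "b > 1/2"
    using a b by simp
  have r: "r k > 0" for k
    unfolding r_def using a b by (auto intro!: divide_pos_pos mult_pos_pos pochhammer_pos)
  have p_eq: "p M k = T k" if "k \<le> 2 * M" for M k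
  proof -
    have "pochhammer (b - 1/2) k > 0"
      using b' by (intro pochhammer_pos) simp
    then show ?thesis
      unfolding p_def sum_gasper_term[OF a b' that] by (simp add: r_def T_def)
  qed
  have p_nonneg: "p M k \<ge> 0" for M k
    unfolding p_def using r[of k] gasper_term_nonneg[OF a b]
    by (intro mult_nonneg_nonneg sum_nonneg) (auto intro: less_imp_le)
  have p_le: "p M k \<le> T k" for M k
  proof -
    \<comment> \<open>Adding nonnegative terms up to M + k reaches the range where the sum is
      exact.\<close>
    have "p M k \<le> p (M + k) k"
      unfolding p_def using r[of k] gasper_term_nonneg[OF a b]
      by (intro mult_right_mono sum_mono2) (auto intro: less_imp_le)
    then show ?thesis
      using p_eq[of k "M + k"] by simp
  qed
  have abs_summable: "summable (\<lambda>k. \<bar>T k * z ^ k\<bar>)"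
    unfolding T_def using a b by (intro summable_pochhammer_series hyp1F2z_coeff_bound) auto
  have partial: "(\<lambda>k. p M k * z ^ k) sums
      (\<Sum>m\<le>M. gasper_coeff a b m * z ^ (2 * m) * (hyp0F1 (b + 2 * real m) (z / 4))\<^sup>2)" for M
  proof -
    have "p M k * z ^ k
        = (\<Sum>m\<le>M. gasper_term a b k m * pochhammer (b - 1/2) k / (fact k * pochhammer b k) * z ^ k)" for k
      unfolding p_def r_def sum_distrib_right by (simp add: mult.assoc)
    then show ?thesis
      using gasper_term_sums[OF b'] by (simp only:) (intro sums_sum)
  qed
  have "norm (hyp1F2z a b (2 * a) z
        - (\<Sum>m\<le>M. gasper_coeff a b m * z ^ (2 * m) * (hyp0F1 (b + 2 * real m) (z / 4))\<^sup>2))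
      \<le> (\<Sum>k. \<bar>T (k + M) * z ^ (k + M)\<bar>)" for M
  proof -
    have "(\<lambda>k. T k * z ^ k) sums hyp1F2z a b (2 * a) z"
      unfolding hyp1F2z_def T_def[symmetric]
      by (rule summable_sums[OF summable_rabs_cancel[OF abs_summable]])
    from sums_diff[OF this partial[of M]]
    have "(\<lambda>k. (T k - p M k) * z ^ k) sums (hyp1F2z a b (2 * a) z
        - (\<Sum>m\<le>M. gasper_coeff a b m * z ^ (2 * m) * (hyp0F1 (b + 2 * real m) (z / 4))\<^sup>2))"
      by (simp add: left_diff_distrib)
    moreover have "(\<Sum>k<M. (T k - p M k) * z ^ k) = 0"
      by (intro sum.neutral) (simp add: p_eq)
    ultimately have rest: "(\<lambda>k. (T (k + M) - p M (k + M)) * z ^ (k + M)) sums (hyp1F2z a b (2 * a) z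
        - (\<Sum>m\<le>M. gasper_coeff a b m * z ^ (2 * m) * (hyp0F1 (b + 2 * real m) (z / 4))\<^sup>2))"
      using sums_iff_shift[of "\<lambda>k. (T k - p M k) * z ^ k" M] by simp
    have le: "norm ((T k - p M k) * z ^ k) \<le> \<bar>T k * z ^ k\<bar>" for k
      unfolding real_norm_def abs_mult
      using p_nonneg[of M k] p_le[of M k] by (intro mult_right_mono) auto
    show ?thesis
      unfolding sums_unique[OF rest]
      using abs_summable by (intro norm_suminf_le le summable_ignore_initial_segment)
  qed
  moreover have "(\<lambda>M. \<Sum>k. \<bar>T (k + M) * z ^ (k + M)\<bar>) \<longlonglongrightarrow> 0"
    by (rule suminf_exist_split2[OF abs_summable])
  ultimately have "(\<lambda>M. hyp1F2z a b (2 * a) z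
        - (\<Sum>m\<le>M. gasper_coeff a b m * z ^ (2 * m) * (hyp0F1 (b + 2 * real m) (z / 4))\<^sup>2)) \<longlonglongrightarrow> 0"
    by (rule Lim_null_comparison[OF always_eventually[OF allI]])
  from tendsto_diff[OF tendsto_const[of "hyp1F2z a b (2 * a) z"] this] show ?thesis
    unfolding sums_def_le by simp
qed

lemma hyp1F2z_gt_square:
  assumes a: "a > 0" and b: "b > a + 1/2" and z: "z \<noteq> 0"
  shows "hyp1F2z a b (2 * a) z > (hyp0F1 b (z / 4))\<^sup>2"
proof -
  define g where "g m = gasper_coeff a b m * z ^ (2 * m) * (hyp0F1 (b + 2 * real m) (z / 4))\<^sup>2" for m
  have g_nonneg: "g m \<ge> 0" for m
    unfolding g_def using gasper_coeff_pos[OF a b, of m] by (intro mult_nonneg_nonneg) auto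
  \<comment> \<open>A term n > 0 whose parameter b + 2 n is large enough for
    \<open>hyp0F1_nonzero\<close>; added to the term m = 0, which is the square itself, it gives
    strictness.\<close>
  obtain n :: nat where n: "real n > exp \<bar>z / 4\<bar>"
    using reals_Archimedean2 by blast
  then have "n > 0"
    by (intro gr0I) (auto simp: not_less[symmetric])
  have "hyp0F1 (b + 2 * real n) (z / 4) \<noteq> 0"
    using n a b by (intro hyp0F1_nonzero) simp
  then have g_pos: "g n > 0"
    unfolding g_def using gasper_coeff_pos[OF a b, of n] z
    by (intro mult_pos_pos) (auto simp: zero_less_power_eq)
  have "(hyp0F1 b (z / 4))\<^sup>2 = g 0"
    by (simp add: g_def gasper_coeff_def gasper_weight_def)
  also have "\<dots> < sum g {0, n}"
    using \<open>n > 0\<close> g_pos by simp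
  also have "\<dots> \<le> suminf g"
    using hyp1F2z_gasper_sums[OF a b, of z] g_nonneg unfolding g_def[symmetric]
    by (intro sum_le_suminf) (auto simp: sums_iff)
  also have "\<dots> = hyp1F2z a b (2 * a) z"
    using hyp1F2z_gasper_sums[OF a b, of z] unfolding g_def[symmetric] by (simp add: sums_iff)
  finally show ?thesis .
qed

section \<open>The boundary case and necessity\<close>

text \<open>The square formula at parameter a + 1/2, where \<open>b - 1/2\<close> becomes a and
  \<open>2 * b - 1\<close> becomes \<open>2 * a\<close>.\<close>

lemma hyp1F2_boundary:
  assumes "a > 0"
  shows "hyp1F2 a (a + 1/2) (2 * a) x = (bessJ (a - 1/2) (x / 2))\<^sup>2"
  using hyp0F1_square_sums[of "a + 1/2" "- (x\<^sup>2) / 4"] assms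
  by (simp add: hyp1F2_def bessJ_eq_hyp0F1 sums_iff power_divide add.commute)

lemma hyp1F2_pos_imp_gt:
  assumes a: "a > 0" and b: "b > 0" and pos: "\<And>x. x > 0 \<Longrightarrow> hyp1F2 a b (2 * a) x > 0"
  shows "b > a + 1/2"
proof (rule ccontr)
  assume "\<not> ?thesis"
  then have le: "b \<le> a + 1/2"
    by simp
  have pos_z: "hyp1F2z a b (2 * a) z > 0" if "z < 0" for z
  proof -
    have "z = - ((2 * sqrt (- z))\<^sup>2) / 4"
      using that by (simp add: power_mult_distrib)
    then have "hyp1F2z a b (2 * a) z = hyp1F2 a b (2 * a) (2 * sqrt (- z))"
      unfolding hyp1F2_eq_hyp1F2z by metis
    then show ?thesis
      using pos that by simp
  qed
  obtain y where y: "y > 0" "bessJ (a - 1/2) y = 0"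
    using bessJ_zero[of "a - 1/2"] a by auto
  \<comment> \<open>The point is x = 2 y because the boundary square is evaluated at x / 2. The
    averaging needs a positive increment, so b = a + 1/2 is treated separately.\<close>
  have "hyp1F2z a (a + 1/2) (2 * a) (- ((2 * y)\<^sup>2) / 4) > 0"
  proof (cases "b = a + 1/2")
    case True
    then show ?thesis
      using pos_z[of "- ((2 * y)\<^sup>2) / 4"] y by simp
  next
    case False
    have "hyp1F2z a (b + (a + 1/2 - b)) (2 * a) (- ((2 * y)\<^sup>2) / 4) > 0"
      unfolding hyp1F2z_def
      by (rule pochhammer_series_pos_raise)
         (use a b le False y pos_z in \<open>auto simp: hyp1F2z_def intro: hyp1F2z_coeff_bound[of a "2 * a", simplified]\<close>)
    then show ?thesis
      by simp
  qed
  then show False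
    using hyp1F2_boundary[OF a, of "2 * y"] y by (simp add: hyp1F2_eq_hyp1F2z)
qed

theorem theorem5:
  fixes a b :: real
  assumes "a > 0" and "b > 0"
  shows "((a, b, 2 * a) \<in> P12 \<longleftrightarrow> b > a + 1/2) \<and>
         ((a, b, 2 * a) \<in> P12 \<longrightarrow> (\<forall>x>0. hyp1F2 a b (2 * a) x > (bessJ (b - 1) (x / 2))^2))"
proof -
  have gt: "hyp1F2 a b (2 * a) x > (bessJ (b - 1) (x / 2))\<^sup>2" if "b > a + 1/2" "x > 0" for x
    using hyp1F2z_gt_square[OF assms(1) that(1), of "- (x\<^sup>2) / 4"] that(2)
    by (simp add: hyp1F2_eq_hyp1F2z bessJ_eq_hyp0F1 power_divide)
  have "(a, b, 2 * a) \<in> P12 \<longleftrightarrow> b > a + 1/2"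
  proof
    assume "(a, b, 2 * a) \<in> P12"
    then show "b > a + 1/2"
      using hyp1F2_pos_imp_gt[OF assms] by (simp add: P12_def)
  next
    assume b: "b > a + 1/2"
    have "hyp1F2 a b (2 * a) x > 0" if "x > 0" for x
      using gt[OF b that] by (rule order.strict_trans1[OF zero_le_power2])
    then show "(a, b, 2 * a) \<in> P12"
      using assms by (simp add: P12_def)
  qed
  then show ?thesis
    using gt by blast
qed

end
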